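(* For all $\Gamma\subseteq\{0,1\}^\infty$, $$\mathrm{Dim}(\Gamma)=\inf \mathscr G^{\mathrm{str}}_{\mathrm{constr}}(\Gamma),$$ where $\mathrm{Dim}(\Gamma)$ is the algorithmic strong dimension of $\Gamma$ and $\mathscr G^{\mathrm{str}}_{\mathrm{constr}}(\Gamma)=\{s\in[0,\infty) : \text{there exists a learning function } l \text{ which strongly algorithmically } s\text{-learns every } X\in\Gamma\}$.
   Context: For $s\in[0,\infty)$, an $s$-gale is a function $d:\{0,1\}^*\to[0,\infty)$ with $d(w)2^{-s|w|}=d(w0)2^{-s(|w|+1)}+d(w1)2^{-s(|w|+1)}$ for all $w$. A function $f:\{0,1\}^*\to[0,\infty)$ is lower semicomputable if there is a computable $g:\{0,1\}^*\times\mathbb N\to\mathbb Q\cap[0,\infty)$ with $g(w,t)\le g(w,t+1)\le f(w)$ and $\lim_t g(w,t)=f(w)$. A gale $d$ succeeds strongly on $X$ if $\liminf_n d(X\upharpoonright n)=\infty$. The algorithmic strong dimension is $\mathrm{Dim}(\Gamma)=\inf\{s\in[0,\infty): \text{some lower semicomputable } s\text{-gale succeeds strongly on every } X\in\Gamma\}$. A learning function is a function $l:\{0,1\}^*\to\{0,1\}$ (yes $=1$, no $=0$). $Y\upharpoonright i$ is the length-$i$ prefix of $Y$; $\lambda$ is the uniform (Lebesgue) measure on $\{0,1\}^\infty$. For nonempty $w$, $\mathrm{AVG}_l(w)=\frac{1}{|w|}\sum_{i=0}^{|w|} l(w\upharpoonright i)$. For $s\ge 0$, $l$ strongly algorithmically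 $s$-learns $X$ iff: (1) the map $w\mapsto \mathrm{AVG}_l(w)$ is lower semicomputable (uniformly in $w$); (2) for all $n\in\mathbb N$, $\lambda(\{Y : \#\{i\in\mathbb N: l(Y\upharpoonright i)=1\}\ge n\})\le 2^{-n}$; (3) $\liminf_{n\to\infty}\mathrm{AVG}_l(X\upharpoonright n)\ge 1-s$. *)

theory Defs
  imports "HOL-Probability.Probability"
begin

text \<open>trec n f: f is a total recursive function of arity n; only its values on
  argument lists of length n are meaningful.\<close>
inductive trec :: "nat \<Rightarrow> (nat list \<Rightarrow> nat) \<Rightarrow> bool" where
  zero: "trec n (\<lambda>_. 0)"
| succ: "trec 1 (\<lambda>xs. Suc (xs ! 0))"
| proj: "i < n \<Longrightarrow> trec n (\<lambda>xs. xs ! i)"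
| comp: "trec m g \<Longrightarrow> length fs = m \<Longrightarrow> (\<forall>f\<in>set fs. trec n f)
         \<Longrightarrow> trec n (\<lambda>xs. g (map (\<lambda>f. f xs) fs))"
| prim: "trec n g \<Longrightarrow> trec (n + 2) h
         \<Longrightarrow> trec (Suc n) (\<lambda>xs. rec_nat (g (tl xs)) (\<lambda>y acc. h (y # acc # tl xs)) (hd xs))"
| mu: "trec (Suc n) f \<Longrightarrow> (\<forall>xs. length xs = n \<longrightarrow> (\<exists>y. f (y # xs) = 0))
         \<Longrightarrow> trec n (\<lambda>xs. LEAST y. f (y # xs) = 0)"

text \<open>Binary strings are bool lists (True = 1). Standard bijective coding into nat.\<close>
fun code_bits :: "bool list \<Rightarrow> nat" where
  "code_bits [] = 0"
| "code_bits (b # w) = 2 * code_bits w + (if b then 2 else 1)"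

definition prefix_seq :: "(nat \<Rightarrow> bool) \<Rightarrow> nat \<Rightarrow> bool list" where
  "prefix_seq X n = map X [0..<n]"

definition computable_qnn :: "(bool list \<Rightarrow> nat \<Rightarrow> real) \<Rightarrow> bool" where
  "computable_qnn g \<longleftrightarrow> (\<exists>N D. trec 2 N \<and> trec 2 D \<and>
     (\<forall>w t. g w t = real (N [code_bits w, t]) / real (Suc (D [code_bits w, t]))))"

definition lower_semicomputable :: "(bool list \<Rightarrow> real) \<Rightarrow> bool" where
  "lower_semicomputable f \<longleftrightarrow> (\<exists>g. computable_qnn g \<and>
     (\<forall>w t. g w t \<le> g w (Suc t) \<and> g w t \<le> f w) \<and>
     (\<forall>w. (\<lambda>t. g w t) \<longlonglongrightarrow> f w))"

definition is_gale :: "real \<Rightarrow> (bool list \<Rightarrow> real) \<Rightarrow> bool" where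
  "is_gale s d \<longleftrightarrow> (\<forall>w. d w \<ge> 0) \<and>
     (\<forall>w. d w * 2 powr (- s * real (length w)) =
          d (w @ [False]) * 2 powr (- s * real (length w + 1))
        + d (w @ [True]) * 2 powr (- s * real (length w + 1)))"

definition succeeds_strongly :: "(bool list \<Rightarrow> real) \<Rightarrow> (nat \<Rightarrow> bool) \<Rightarrow> bool" where
  "succeeds_strongly d X \<longleftrightarrow> liminf (\<lambda>n. ereal (d (prefix_seq X n))) = \<infinity>"

definition strong_dim :: "(nat \<Rightarrow> bool) set \<Rightarrow> real" where
  "strong_dim \<Gamma> = Inf {s. s \<ge> 0 \<and> (\<exists>d. lower_semicomputable d \<and> is_gale s d \<and>
                          (\<forall>X\<in>\<Gamma>. succeeds_strongly d X))}"

definition cantor_measure :: "(nat \<Rightarrow> bool) measure" where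
  "cantor_measure = PiM UNIV (\<lambda>_. measure_pmf (bernoulli_pmf (1/2)))"

text \<open>AVG_l(w) = (1/|w|) * sum_{i=0}^{|w|} l(w|i); for w = [] this gives 0 (1/0 = 0).\<close>
definition AVG :: "(bool list \<Rightarrow> bool) \<Rightarrow> bool list \<Rightarrow> real" where
  "AVG l w = (1 / real (length w)) * (\<Sum>i\<in>{0..length w}. of_bool (l (take i w)))"

definition yes_count_ge :: "(bool list \<Rightarrow> bool) \<Rightarrow> nat \<Rightarrow> (nat \<Rightarrow> bool) \<Rightarrow> bool" where
  "yes_count_ge l n Y \<longleftrightarrow>
     infinite {i. l (prefix_seq Y i)} \<or> n \<le> card {i. l (prefix_seq Y i)}"

definition strongly_alg_learns :: "real \<Rightarrow> (bool list \<Rightarrow> bool) \<Rightarrow> (nat \<Rightarrow> bool) \<Rightarrow> bool" where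
  "strongly_alg_learns s l X \<longleftrightarrow>
     lower_semicomputable (AVG l) \<and>
     (\<forall>n. emeasure cantor_measure {Y \<in> space cantor_measure. yes_count_ge l n Y}
            \<le> ennreal ((1/2) ^ n)) \<and>
     liminf (\<lambda>n. ereal (AVG l (prefix_seq X n))) \<ge> ereal (1 - s)"

definition G_str_constr :: "(nat \<Rightarrow> bool) set \<Rightarrow> real set" where
  "G_str_constr \<Gamma> = {s. s \<ge> 0 \<and> (\<exists>l. \<forall>X\<in>\<Gamma>. strongly_alg_learns s l X)}"

end

(* Let S(w) be the number of prefixes of w to which a learner says yes. If the learner s-learns X and
   0 < a < 1 - s is rational, all but finitely many prefixes v of X lie in the enumerable set
   {v. AVG v > a}, which by the measure condition has at most 2^((1-a)m) strings of length m. Weighting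
   every v in this set by the right geometric factor gives, for any exponent above 1 - a, a lower
   semicomputable gale that succeeds strongly on X. Conversely, an s-gale, rescaled by a rational
   base slightly below 2^(1-s), is a supermartingale; the learner that says yes whenever the
   supermartingale passes a new power of two satisfies the measure condition by Ville's inequality,
   and S(w) is the integer part of the logarithm of the running maximum of the supermartingale. *)
theory Submission
  imports Defs
begin

section \<open>Total recursive functions\<close>

text \<open>Each conversion loses an arbitrarily small amount in the exponent, which is enough for
  the infima. The slack pays for rationality: \<open>2 powr s\<close> need be neither rational nor
  computable, whereas the approximations in \<open>lower_semicomputable\<close> have rational
  values. A gale must satisfy an exact identity, so its exponent is moved to the logarithm of a
  rational; a supermartingale needs only an inequality, so there the base is rounded instead. A
  second obstacle is the learner: its single answers may flip while the gale is being approximated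
  from below. The number of passed thresholds can only grow, and condition (1) asks about
  \<open>AVG l\<close>, not about \<open>l\<close>.\<close>

text \<open>The values of a \<^const>\<open>trec\<close> function on lists of the wrong length are an
  artefact of the syntax; \<open>computable\<close> forgets them.\<close>

definition computable :: "nat \<Rightarrow> (nat list \<Rightarrow> nat) \<Rightarrow> bool" where
  "computable n f \<longleftrightarrow> (\<exists>f'. trec n f' \<and> (\<forall>xs. length xs = n \<longrightarrow> f xs = f' xs))"

lemma computable_cong:
  "computable n f \<Longrightarrow> (\<And>xs. length xs = n \<Longrightarrow> f xs = g xs) \<Longrightarrow> computable n g"
  unfolding computable_def by metis

lemma computable_trec: "trec n f \<Longrightarrow> computable n f"
  unfolding computable_def by blast

lemma computable_proj: "i < n \<Longrightarrow> computable n (\<lambda>xs. xs ! i)"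
  by (intro computable_trec trec.proj)

text \<open>The rules for recursion and sums below present bound variables as \<open>hd ys\<close>
  and \<open>hd (tl ys)\<close> and parameters through \<open>tl\<close>; projections in this shape
  let \<open>intro\<close> close those goals.\<close>

lemma computable_hd: "0 < n \<Longrightarrow> computable n hd"
  by (rule computable_cong[OF computable_proj[of 0]]) (auto simp: hd_conv_nth)

lemma computable_tl_proj: "Suc i < n \<Longrightarrow> computable n (\<lambda>xs. tl xs ! i)"
  by (rule computable_cong[OF computable_proj[of "Suc i"]]) (auto simp: nth_tl)

lemma computable_hd_tl: "1 < n \<Longrightarrow> computable n (\<lambda>xs. hd (tl xs))"
  by (rule computable_cong[OF computable_proj[of 1]])
    (auto simp: hd_conv_nth nth_tl simp flip: length_greater_0_conv)

lemma computable_tl_tl_proj: "Suc (Suc i) < n \<Longrightarrow> computable n (\<lambda>xs. tl (tl xs) ! i)"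
  by (rule computable_cong[OF computable_proj[of "Suc (Suc i)"]]) (auto simp: nth_tl)

lemma computable_comp1:
  assumes "computable 1 (\<lambda>xs. h (xs ! 0))" "computable n f"
  shows "computable n (\<lambda>xs. h (f xs))"
proof -
  obtain h' f' where h': "trec 1 h'" "\<And>xs. length xs = 1 \<Longrightarrow> h (xs ! 0) = h' xs"
    and f': "trec n f'" "\<And>xs. length xs = n \<Longrightarrow> f xs = f' xs"
    using assms unfolding computable_def by blast
  have "trec n (\<lambda>xs. h' (map (\<lambda>f. f xs) [f']))"
    using h' f' by (intro trec.comp) auto
  moreover have "h (f xs) = h' (map (\<lambda>f. f xs) [f'])" if "length xs = n" for xs
    using h'(2)[of "[f' xs]"] f'(2)[OF that] by simp
  ultimately show ?thesis unfolding computable_def by blast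
qed

lemma computable_comp2:
  assumes "computable 2 h" "computable n f" "computable n g"
  shows "computable n (\<lambda>xs. h [f xs, g xs])"
proof -
  obtain h' f' g' where h': "trec 2 h'" "\<And>xs. length xs = 2 \<Longrightarrow> h xs = h' xs"
    and f': "trec n f'" "\<And>xs. length xs = n \<Longrightarrow> f xs = f' xs"
    and g': "trec n g'" "\<And>xs. length xs = n \<Longrightarrow> g xs = g' xs"
    using assms unfolding computable_def by metis
  have "trec n (\<lambda>xs. h' (map (\<lambda>f. f xs) [f', g']))"
    using h' f' g' by (intro trec.comp[of 2]) auto
  moreover have "h [f xs, g xs] = h' (map (\<lambda>f. f xs) [f', g'])" if "length xs = n" for xs
    using h'(2)[of "[f' xs, g' xs]"] f'(2)[OF that] g'(2)[OF that] by simp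
  ultimately show ?thesis unfolding computable_def by blast
qed

lemma computable_Suc: "computable n f \<Longrightarrow> computable n (\<lambda>xs. Suc (f xs))"
  by (rule computable_comp1[OF computable_trec[OF trec.succ]])

lemma computable_const: "computable n (\<lambda>_. c)"
proof (induction c)
  case 0
  show ?case by (intro computable_trec trec.zero)
next
  case (Suc c)
  then show ?case by (rule computable_Suc)
qed

lemma computable_rec_nat:
  assumes "computable n f" "computable n g"
    and "computable (Suc (Suc n)) (\<lambda>ys. h (hd ys) (hd (tl ys)) (tl (tl ys)))"
  shows "computable n (\<lambda>xs. rec_nat (g xs) (\<lambda>y acc. h y acc xs) (f xs))"
proof -
  obtain f' g' h' where f': "trec n f'" "\<And>xs. length xs = n \<Longrightarrow> f xs = f' xs"
    and g': "trec n g'" "\<And>xs. length xs = n \<Longrightarrow> g xs = g' xs"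
    and h': "trec (n + 2) h'"
      "\<And>ys. length ys = Suc (Suc n) \<Longrightarrow> h (hd ys) (hd (tl ys)) (tl (tl ys)) = h' ys"
    using assms unfolding computable_def by auto
  define F where "F = (\<lambda>xs. rec_nat (g' (tl xs)) (\<lambda>y acc. h' (y # acc # tl xs)) (hd xs))"
  \<comment> \<open>The scheme \<open>trec.prim\<close> recurses on the head and keeps the tail as
    parameters, so it is applied to \<open>f xs # xs\<close>.\<close>
  define fs where "fs = f' # map (\<lambda>i xs. xs ! i) [0..<n]"
  have "trec n (\<lambda>xs. F (map (\<lambda>f. f xs) fs))"
    unfolding F_def using f'(1) g'(1) h'(1)
    by (intro trec.comp[of "Suc n"] trec.prim) (auto simp: fs_def intro: trec.proj)
  moreover have "rec_nat (g xs) (\<lambda>y acc. h y acc xs) (f xs) = F (map (\<lambda>f. f xs) fs)"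
    if "length xs = n" for xs
  proof -
    have "map (\<lambda>f. f xs) fs = f xs # xs"
      using that by (simp add: fs_def f'(2) comp_def map_nth flip: that)
    moreover have "h y acc xs = h' (y # acc # xs)" for y acc
      using h'(2)[of "y # acc # xs"] that by simp
    ultimately show ?thesis using g'(2)[OF that] by (simp add: F_def)
  qed
  ultimately show ?thesis unfolding computable_def by blast
qed

lemmas computable_basic = computable_const computable_proj computable_hd computable_tl_proj
  computable_hd_tl computable_tl_tl_proj computable_Suc

section \<open>Arithmetic, bounded sums and bounded search\<close>

lemma computable_add:
  assumes "computable n f" "computable n g"
  shows "computable n (\<lambda>xs. f xs + g xs)"
proof -
  have "rec_nat a (\<lambda>_ acc. Suc acc) b = b + a" for a b :: nat
    by (induction b) auto
  then show ?thesis
    using computable_rec_nat[OF assms, of "\<lambda>_ acc _. Suc acc"] by (simp add: computable_basic)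
qed

lemma computable_mult:
  assumes "computable n f" "computable n g"
  shows "computable n (\<lambda>xs. f xs * g xs)"
proof -
  have eq: "rec_nat 0 (\<lambda>_ acc. acc + b) a = a * b" for a b :: nat
    by (induction a) auto
  \<comment> \<open>With two plain variables nothing has to be shifted past the counter and the
    accumulator; \<open>f\<close> and \<open>g\<close> are plugged in afterwards by
    composition.\<close>
  have "computable 2 (\<lambda>xs. rec_nat 0 (\<lambda>_ acc. acc + xs ! 1) (xs ! 0))"
    by (intro computable_rec_nat computable_basic computable_add) auto
  from computable_comp2[OF this assms] show ?thesis by (simp add: eq)
qed

lemma computable_power:
  assumes "computable n f" "computable n g"
  shows "computable n (\<lambda>xs. f xs ^ g xs)"
proof -
  have eq: "rec_nat 1 (\<lambda>_ acc. acc * a) b = a ^ b" for a b :: nat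
    by (induction b) auto
  have "computable 2 (\<lambda>xs. rec_nat 1 (\<lambda>_ acc. acc * xs ! 0) (xs ! 1))"
    by (intro computable_rec_nat computable_basic computable_mult) auto
  from computable_comp2[OF this assms] show ?thesis by (simp only: eq) simp
qed

lemma computable_diff:
  assumes "computable n f" "computable n g"
  shows "computable n (\<lambda>xs. f xs - g xs)"
proof -
  have pred: "rec_nat 0 (\<lambda>y _. y) a = a - 1" for a :: nat
    by (cases a) auto
  have "computable 1 (\<lambda>xs. rec_nat 0 (\<lambda>y _. y) (xs ! 0))"
    by (intro computable_rec_nat computable_basic) auto
  then have "computable 1 (\<lambda>xs. xs ! 0 - 1)"
    by (simp only: pred)
  note p = computable_comp1[OF this]
  have eq: "rec_nat a (\<lambda>_ acc. acc - 1) b = a - b" for a b :: nat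
    by (induction b) auto
  have "computable 2 (\<lambda>xs. rec_nat (xs ! 0) (\<lambda>_ acc. acc - 1) (xs ! 1))"
    by (intro computable_rec_nat p computable_basic) auto
  from computable_comp2[OF this assms] show ?thesis by (simp only: eq) simp
qed

lemma computable_less:
  assumes "computable n f" "computable n g"
  shows "computable n (\<lambda>xs. of_bool (f xs < g xs))"
proof -
  have "computable n (\<lambda>xs. 1 - (1 - (g xs - f xs)))"
    by (intro computable_diff computable_const assms)
  then show ?thesis by (rule computable_cong) auto
qed

lemma computable_eq:
  assumes "computable n f" "computable n g"
  shows "computable n (\<lambda>xs. of_bool (f xs = g xs))"
proof -
  have "computable n (\<lambda>xs. 1 - ((f xs - g xs) + (g xs - f xs)))"
    by (intro computable_diff computable_add computable_const assms)
  then show ?thesis by (rule computable_cong) auto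
qed

lemma computable_conj:
  assumes "computable n (\<lambda>xs. of_bool (P xs))" "computable n (\<lambda>xs. of_bool (Q xs))"
  shows "computable n (\<lambda>xs. of_bool (P xs \<and> Q xs))"
  using computable_mult[OF assms] by (simp add: of_bool_conj)

lemma computable_mod:
  assumes "computable n f" "computable n g"
  shows "computable n (\<lambda>xs. f xs mod g xs)"
proof -
  \<comment> \<open>A counter that is reset on reaching \<open>b\<close>; for \<open>b = 0\<close>
    it never resets, matching \<open>a mod 0 = a\<close>.\<close>
  have eq: "rec_nat 0 (\<lambda>_ acc. Suc acc * (1 - of_bool (Suc acc = b))) a = a mod b" for a b :: nat
    by (induction a) (auto simp: mod_Suc)
  have "computable 2 (\<lambda>xs. rec_nat 0 (\<lambda>_ acc. Suc acc * (1 - of_bool (Suc acc = xs ! 1))) (xs ! 0))"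
    by (intro computable_rec_nat computable_basic computable_mult computable_diff computable_eq) auto
  from computable_comp2[OF this assms] show ?thesis by (simp only: eq) simp
qed

lemma computable_sum:
  assumes "computable n f" "computable (Suc n) (\<lambda>ys. g (hd ys) (tl ys))"
  shows "computable n (\<lambda>xs. \<Sum>i<f xs. g i xs)"
proof -
  have eq: "rec_nat 0 (\<lambda>y acc. acc + h y) a = (\<Sum>i<a. h i)" for a :: nat and h :: "nat \<Rightarrow> nat"
    by (induction a) auto
  obtain g' where g': "trec (Suc n) g'" "\<And>ys. length ys = Suc n \<Longrightarrow> g (hd ys) (tl ys) = g' ys"
    using assms(2) unfolding computable_def by blast
  obtain p0 where p0: "trec (Suc (Suc n)) p0" "\<And>ys. length ys = Suc (Suc n) \<Longrightarrow> hd ys = p0 ys"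
    using computable_hd[of "Suc (Suc n)"] unfolding computable_def by auto
  \<comment> \<open>Here the summand depends on the parameters and must be shifted: these
    projections skip the accumulator, which sits at position 1.\<close>
  define fs where "fs = p0 # map (\<lambda>i ys. ys ! (i + 2)) [0..<n]"
  have "trec (Suc (Suc n)) (\<lambda>ys. g' (map (\<lambda>f. f ys) fs))"
    using g'(1) p0(1) by (intro trec.comp) (auto simp: fs_def intro!: trec.proj[where n = "Suc (Suc n)"])
  moreover have "g (hd ys) (tl (tl ys)) = g' (map (\<lambda>f. f ys) fs)" if "length ys = Suc (Suc n)" for ys
  proof -
    have "map (\<lambda>f. f ys) fs = hd ys # tl (tl ys)"
      using that by (auto simp: fs_def p0(2) nth_tl intro!: nth_equalityI)
    then show ?thesis using g'(2)[of "hd ys # tl (tl ys)"] that by simp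
  qed
  ultimately have "computable (Suc (Suc n)) (\<lambda>ys. g (hd ys) (tl (tl ys)))"
    unfolding computable_def by blast
  then have "computable n (\<lambda>xs. rec_nat 0 (\<lambda>y acc. acc + g y xs) (f xs))"
    by (intro computable_rec_nat computable_add assms(1) computable_basic) auto
  then show ?thesis by (simp only: eq)
qed

lemma computable_bex:
  assumes "computable n f" "computable (Suc n) (\<lambda>ys. of_bool (P (hd ys) (tl ys)))"
  shows "computable n (\<lambda>xs. of_bool (\<exists>i<f xs. P i xs))"
proof -
  have "computable n (\<lambda>xs. of_bool (0 < (\<Sum>i<f xs. of_bool (P i xs) :: nat)))"
    by (intro computable_less computable_sum assms computable_const)
  then show ?thesis by (rule computable_cong) (auto simp: Suc_le_eq sum_pos2)
qed

lemmas computable_intros = computable_basic computable_add computable_mult computable_power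
  computable_diff computable_less computable_eq computable_conj computable_mod
  computable_sum computable_bex

lemma computable_qnnI:
  assumes "computable 2 N" "computable 2 D"
    and "\<And>w t. g w t = real (N [code_bits w, t]) / real (Suc (D [code_bits w, t]))"
  shows "computable_qnn g"
proof -
  obtain N' D' where "trec 2 N'" "trec 2 D'"
    "\<And>xs. length xs = 2 \<Longrightarrow> N xs = N' xs" "\<And>xs. length xs = 2 \<Longrightarrow> D xs = D' xs"
    using assms(1,2) unfolding computable_def by blast
  then show ?thesis
    unfolding computable_qnn_def assms(3) by (intro exI[of _ N'] exI[of _ D']) simp
qed

section \<open>Codes of binary strings\<close>

abbreviation bits_val :: "bool list \<Rightarrow> nat" where
  "bits_val w \<equiv> horner_sum of_bool 2 w"

text \<open>In binary, the code plus one is a leading 1 above the bits of \<open>w\<close>, first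
  bit lowest. Length and truncation thus become arithmetic on codes.\<close>

lemma Suc_code_bits: "Suc (code_bits w) = 2 ^ length w + bits_val w"
  by (induction w) auto

lemma bits_val_less: "bits_val w < 2 ^ length w"
  by (induction w) auto

lemma bits_val_take: "bits_val (take i w) = bits_val w mod 2 ^ i"
  using take_bit_horner_sum_bit_eq[of i w, where ?'a = nat] by (simp add: take_bit_eq_mod)

lemma bij_code_bits: "bij code_bits"
proof (rule bijI)
  show "inj code_bits"
  proof (rule injI)
    fix v w assume "code_bits v = code_bits w"
    then show "v = w"
    proof (induction v arbitrary: w)
      case Nil
      then show ?case by (cases w) (auto split: if_splits)
    next
      case (Cons a v)
      then obtain b u where w: "w = b # u" by (cases w) (auto split: if_splits)
      have "a = b \<and> code_bits v = code_bits u"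
        using Cons.prems unfolding w by (auto split: if_splits; presburger)
      then show ?case using Cons.IH w by auto
    qed
  qed
  have "\<exists>w. code_bits w = n" for n
  proof (induction n rule: less_induct)
    case (less n)
    show ?case
    proof (cases "n = 0")
      case True
      then show ?thesis by (intro exI[of _ "[]"]) simp
    next
      case False
      then have "(n - 1) div 2 < n" by auto
      then obtain w where "code_bits w = (n - 1) div 2" using less by blast
      with False show ?thesis
        by (intro exI[of _ "even n # w"]) (auto elim!: oddE evenE)
    qed
  qed
  then show "surj code_bits" by (metis surjI)
qed

definition decode :: "nat \<Rightarrow> bool list" where
  "decode = inv code_bits"

lemma code_decode [simp]: "code_bits (decode n) = n"
  by (simp add: decode_def bij_code_bits bij_is_surj surj_f_inv_f)

lemma decode_code [simp]: "decode (code_bits w) = w"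
  by (simp add: decode_def bij_code_bits bij_is_inj)

lemma inj_decode: "inj decode"
  by (metis code_decode injI)

lemma length_decode_le: "length (decode n) \<le> n"
proof -
  have "length w \<le> code_bits w" for w by (induction w) auto
  from this[of "decode n"] show ?thesis by simp
qed

text \<open>The integer part of the binary logarithm of \<open>Suc c\<close>, written as a bounded
  count so that the closure rules for sums apply.\<close>

definition code_length :: "nat \<Rightarrow> nat" where
  "code_length c = (\<Sum>j<Suc c. of_bool (2 ^ Suc j < Suc (Suc c)))"

lemma code_length_code_bits [simp]: "code_length (code_bits w) = length w"
proof -
  let ?c = "code_bits w"
  have *: "2 ^ length w \<le> Suc ?c" "Suc ?c < 2 ^ Suc (length w)"
    using Suc_code_bits[of w] bits_val_less[of w] by auto
  have "2 ^ Suc j < Suc (Suc ?c) \<longleftrightarrow> j < length w" for j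
  proof
    assume "2 ^ Suc j < Suc (Suc ?c)"
    then have "(2::nat) ^ Suc j < 2 ^ Suc (length w)" using * by linarith
    then show "j < length w" using power_strict_increasing_iff[of "2::nat" "Suc j" "Suc (length w)"] by simp
  next
    assume "j < length w"
    then have "(2::nat) ^ Suc j \<le> 2 ^ length w" by (intro power_increasing) auto
    then show "2 ^ Suc j < Suc (Suc ?c)" using * by linarith
  qed
  moreover have "{..<Suc ?c} \<inter> {j. j < length w} = {..<length w}"
    using length_decode_le[of ?c] by auto
  ultimately show ?thesis
    by (simp only: code_length_def sum.inter_filter[symmetric] sum_of_bool_eq finite_lessThan) simp
qed

lemma code_length_eq: "code_length n = length (decode n)"
  using code_length_code_bits[of "decode n"] by simp

lemma computable_code_length:
  assumes "computable n f"
  shows "computable n (\<lambda>xs. code_length (f xs))"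
proof (rule computable_comp1[OF _ assms])
  show "computable 1 (\<lambda>xs. code_length (xs ! 0))"
    unfolding code_length_def by (intro computable_intros) auto
qed

text \<open>Reduction mod \<open>2 ^ i\<close> removes the leading 1 together with the later bits,
  as \<open>i \<le> length w\<close>; adding \<open>2 ^ i - 1\<close> sets a new leading 1 and
  undoes \<open>Suc\<close>.\<close>

lemma code_bits_take:
  assumes "i \<le> length w"
  shows "code_bits (take i w) = 2 ^ i - 1 + Suc (code_bits w) mod 2 ^ i"
proof -
  have "(2::nat) ^ i dvd 2 ^ length w" using assms by (rule le_imp_power_dvd)
  then have "Suc (code_bits w) mod 2 ^ i = bits_val w mod 2 ^ i"
    by (simp add: Suc_code_bits mod_add_eq[symmetric, of "2 ^ length w"] dvd_imp_mod_0)
  then show ?thesis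
    using Suc_code_bits[of "take i w"] assms by (simp add: bits_val_take)
qed

section \<open>Counting strings and measuring sequences\<close>

lemma length_prefix_seq [simp]: "length (prefix_seq X n) = n"
  by (simp add: prefix_seq_def)

lemma take_prefix_seq: "i \<le> n \<Longrightarrow> take i (prefix_seq X n) = prefix_seq X i"
  by (simp add: prefix_seq_def take_map)

lemma nth_prefix_seq: "i < n \<Longrightarrow> prefix_seq X n ! i = X i"
  by (simp add: prefix_seq_def)

lemma finite_strings: "finite {v :: bool list. length v = n \<and> P v}"
  using finite_lists_length_eq[of "UNIV :: bool set" n] by (rule finite_subset[rotated]) auto

lemma space_cantor_measure [simp]: "space cantor_measure = UNIV"
  by (simp add: cantor_measure_def space_PiM)

lemma prob_space_cantor_measure: "prob_space cantor_measure"
  unfolding cantor_measure_def by (intro prob_space_PiM prob_space_measure_pmf)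

lemma cylinder:
  shows sets_cylinder: "{Y. prefix_seq Y (length v) = v} \<in> sets cantor_measure"
    and emeasure_cylinder:
      "emeasure cantor_measure {Y. prefix_seq Y (length v) = v} = ennreal ((1 / 2) ^ length v)"
proof -
  interpret product_prob_space "\<lambda>_. measure_pmf (bernoulli_pmf (1/2))" "UNIV :: nat set"
    by unfold_locales
  have eq: "{Y. prefix_seq Y (length v) = v} =
    {Y \<in> space cantor_measure. \<forall>i\<in>{..<length v}. Y i \<in> {v ! i}}"
    using list_eq_iff_nth_eq[of "prefix_seq Y (length v)" v for Y]
    by (simp add: nth_prefix_seq Ball_def)
  show "{Y. prefix_seq Y (length v) = v} \<in> sets cantor_measure"
    unfolding eq cantor_measure_def by (intro sets.sets_Collect_finite_All sets_Collect_single) auto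
  have half: "emeasure (measure_pmf (bernoulli_pmf (1/2))) {b} = ennreal (1 / 2)" for b
    by (cases b) (simp_all add: emeasure_pmf_single)
  have "emeasure cantor_measure {Y. prefix_seq Y (length v) = v} = (\<Prod>i<length v. ennreal (1 / 2))"
    unfolding eq cantor_measure_def by (subst emeasure_PiM_Collect) (simp_all add: half)
  also have "\<dots> = ennreal ((1 / 2) ^ length v)"
    by (simp only: prod_constant card_lessThan) (rule ennreal_power, simp)
  finally show "emeasure cantor_measure {Y. prefix_seq Y (length v) = v} = ennreal ((1 / 2) ^ length v)" .
qed

lemma prefix_event:
  fixes P :: "bool list \<Rightarrow> bool"
  shows sets_prefix_event: "{Y. P (prefix_seq Y n)} \<in> sets cantor_measure"
    and emeasure_prefix_event: "emeasure cantor_measure {Y. P (prefix_seq Y n)} =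
      ennreal (real (card {v. length v = n \<and> P v}) / 2 ^ n)"
proof -
  let ?V = "{v. length v = n \<and> P v}" and ?C = "\<lambda>v. {Y. prefix_seq Y (length v) = v}"
  have eq: "{Y. P (prefix_seq Y n)} = (\<Union>v\<in>?V. ?C v)"
    by auto
  show "{Y. P (prefix_seq Y n)} \<in> sets cantor_measure"
    unfolding eq using finite_strings by (intro sets.finite_UN sets_cylinder)
  have "emeasure cantor_measure {Y. P (prefix_seq Y n)} = (\<Sum>v\<in>?V. emeasure cantor_measure (?C v))"
    unfolding eq by (rule sum_emeasure[symmetric])
      (use finite_strings in \<open>auto simp: sets_cylinder disjoint_family_on_def\<close>)
  also have "\<dots> = (\<Sum>v\<in>?V. ennreal ((1 / 2) ^ n))"
  proof (intro sum.cong refl)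
    fix v assume "v \<in> ?V"
    then show "emeasure cantor_measure (?C v) = ennreal ((1 / 2) ^ n)"
      using emeasure_cylinder[of v] by simp
  qed
  also have "\<dots> = ennreal (\<Sum>v\<in>?V. (1 / 2) ^ n)"
    by (rule sum_ennreal) simp
  also have "(\<Sum>v\<in>?V. (1 / 2 :: real) ^ n) = real (card ?V) / 2 ^ n"
    by (simp add: power_divide)
  finally show "emeasure cantor_measure {Y. P (prefix_seq Y n)} = ennreal (real (card ?V) / 2 ^ n)" .
qed

section \<open>Counting yes answers along a sequence\<close>

definition yes_count :: "(bool list \<Rightarrow> bool) \<Rightarrow> bool list \<Rightarrow> nat" where
  "yes_count l w = (\<Sum>i\<le>length w. of_bool (l (take i w)))"

lemma AVG_yes_count: "AVG l w = real (yes_count l w) / real (length w)"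
  by (simp add: AVG_def yes_count_def atLeast0AtMost of_nat_sum)

lemma yes_count_prefix: "yes_count l (prefix_seq Y k) = card {i. i \<le> k \<and> l (prefix_seq Y i)}"
proof -
  have "yes_count l (prefix_seq Y k) = (\<Sum>i\<le>k. of_bool (l (prefix_seq Y i)))"
    by (simp add: yes_count_def take_prefix_seq)
  also have "\<dots> = card ({..k} \<inter> {i. l (prefix_seq Y i)})"
    by (simp add: sum_of_bool_eq)
  also have "{..k} \<inter> {i. l (prefix_seq Y i)} = {i. i \<le> k \<and> l (prefix_seq Y i)}"
    by auto
  finally show ?thesis .
qed

text \<open>Some finite prefix already witnesses the event, whether the yes answers are finite or
  infinite in number; so it is a countable union of prefix events.\<close>

lemma yes_count_ge_iff: "yes_count_ge l n Y \<longleftrightarrow> (\<exists>k. n \<le> yes_count l (prefix_seq Y k))"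
proof
  assume "yes_count_ge l n Y"
  then obtain F where F: "finite F" "F \<subseteq> {i. l (prefix_seq Y i)}" "n \<le> card F"
    unfolding yes_count_ge_def by (metis infinite_arbitrarily_large order_refl)
  then obtain k where "F \<subseteq> {..k}"
    using finite_nat_iff_bounded_le by blast
  with F have "F \<subseteq> {i. i \<le> k \<and> l (prefix_seq Y i)}"
    by auto
  then have "card F \<le> yes_count l (prefix_seq Y k)"
    unfolding yes_count_prefix by (intro card_mono) auto
  with F(3) have "n \<le> yes_count l (prefix_seq Y k)"
    by simp
  then show "\<exists>k. n \<le> yes_count l (prefix_seq Y k)" ..
next
  assume "\<exists>k. n \<le> yes_count l (prefix_seq Y k)"
  then obtain k where k: "n \<le> card {i. i \<le> k \<and> l (prefix_seq Y i)}"
    by (auto simp: yes_count_prefix)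
  show "yes_count_ge l n Y"
    unfolding yes_count_ge_def
  proof (intro disjCI)
    assume "\<not> n \<le> card {i. l (prefix_seq Y i)}"
    then show "infinite {i. l (prefix_seq Y i)}"
      using k card_mono[of "{i. l (prefix_seq Y i)}" "{i. i \<le> k \<and> l (prefix_seq Y i)}"] by auto
  qed
qed

lemma sets_yes_count_ge: "{Y. yes_count_ge l n Y} \<in> sets cantor_measure"
proof -
  have "{Y. yes_count_ge l n Y} = (\<Union>k. {Y. n \<le> yes_count l (prefix_seq Y k)})"
    by (auto simp: yes_count_ge_iff)
  also have "\<dots> \<in> sets cantor_measure"
    by (intro sets.countable_UN) (auto intro: sets_prefix_event)
  finally show ?thesis .
qed

text \<open>Once \<open>v\<close> has \<open>n\<close> yes answers, all its infinite extensions lie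
  in the event, so its measure bounds a count.\<close>

lemma card_yes_count_ge:
  assumes "emeasure cantor_measure {Y. yes_count_ge l n Y} \<le> ennreal ((1 / 2) ^ n)"
  shows "real (card {v. length v = m \<and> n \<le> yes_count l v}) \<le> 2 ^ m / 2 ^ n"
proof -
  have "ennreal (real (card {v. length v = m \<and> n \<le> yes_count l v}) / 2 ^ m) =
      emeasure cantor_measure {Y. n \<le> yes_count l (prefix_seq Y m)}"
    by (rule emeasure_prefix_event[symmetric])
  also have "\<dots> \<le> emeasure cantor_measure {Y. yes_count_ge l n Y}"
    by (intro emeasure_mono sets_yes_count_ge) (auto simp: yes_count_ge_iff)
  also note assms
  finally have "real (card {v. length v = m \<and> n \<le> yes_count l v}) / 2 ^ m \<le> (1 / 2) ^ n"
    by simp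
  then show ?thesis by (simp add: field_simps power_divide)
qed

section \<open>Supermartingales\<close>

lemma strings_Suc_eq:
  "{v. length v = Suc k \<and> P v} =
    (\<lambda>v. False # v) ` {v. length v = k \<and> P (False # v)} \<union> (\<lambda>v. True # v) ` {v. length v = k \<and> P (True # v)}"
proof -
  have "v \<in> (\<lambda>v. b # v) ` {v. length v = k \<and> P (b # v)} \<longleftrightarrow>
      length v = Suc k \<and> P v \<and> hd v = b" for v b
    by (cases v) auto
  then show ?thesis by auto
qed

lemma card_strings_Suc:
  "card {v. length v = Suc k \<and> P v} =
    card {v. length v = k \<and> P (False # v)} + card {v. length v = k \<and> P (True # v)}"
  unfolding strings_Suc_eq
  by (subst card_Un_disjoint) (auto simp: finite_strings card_image inj_on_def)

lemma card_all_strings: "card {v :: bool list. length v = k} = 2 ^ k"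
  using card_lists_length_eq[of "UNIV :: bool set" k] by simp

text \<open>Optional stopping done by counting, with the start \<open>w\<close> free for the
  induction. If \<open>c < m w\<close>, this alone pays for all \<open>2 ^ k\<close> continuations;
  otherwise the first bit is split off and the supermartingale inequality combines the two
  halves.\<close>

lemma ville_count:
  fixes m :: "bool list \<Rightarrow> real"
  assumes "c \<ge> 0" "\<And>w. m w \<ge> 0" "\<And>w. m (w @ [False]) + m (w @ [True]) \<le> 2 * m w"
  shows "c * real (card {v. length v = k \<and> (\<exists>i\<le>k. c < m (w @ take i v))}) \<le> 2 ^ k * m w"
proof (induction k arbitrary: w)
  case 0
  have "{v. length v = 0 \<and> (\<exists>i\<le>0. c < m (w @ take i v))} = (if c < m w then {[]} else {})"
    by auto
  then show ?case using assms(2)[of w] by auto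
next
  case (Suc k)
  show ?case
  proof (cases "c < m w")
    case True
    have "card {v. length v = Suc k \<and> (\<exists>i\<le>Suc k. c < m (w @ take i v))} \<le> 2 ^ Suc k"
      unfolding card_all_strings[symmetric] using finite_strings[of "Suc k" "\<lambda>_. True"]
      by (intro card_mono) auto
    then have "real (card {v. length v = Suc k \<and> (\<exists>i\<le>Suc k. c < m (w @ take i v))}) \<le> real (2 ^ Suc k)"
      by (simp only: of_nat_le_iff)
    then have "c * real (card {v. length v = Suc k \<and> (\<exists>i\<le>Suc k. c < m (w @ take i v))}) \<le> m w * real (2 ^ Suc k)"
      using True assms(1,2) by (intro mult_mono) auto
    then show ?thesis by (simp add: mult_ac)
  next
    case False
    have "(\<exists>i\<le>Suc k. Q i) \<longleftrightarrow> Q 0 \<or> (\<exists>i\<le>k. Q (Suc i))" for Q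
      by (metis Suc_le_mono le0 not0_implies_Suc)
    then have "(\<exists>i\<le>Suc k. c < m (w @ take i (b # v))) \<longleftrightarrow> (\<exists>i\<le>k. c < m ((w @ [b]) @ take i v))" for b v
      using False by simp
    then have "c * real (card {v. length v = Suc k \<and> (\<exists>i\<le>Suc k. c < m (w @ take i v))}) \<le>
        2 ^ k * m (w @ [False]) + 2 ^ k * m (w @ [True])"
      unfolding card_strings_Suc
      using Suc.IH[of "w @ [False]"] Suc.IH[of "w @ [True]"] by (simp add: distrib_left)
    also have "\<dots> \<le> 2 ^ Suc k * m w"
      using mult_left_mono[OF assms(3)[of w], of "2 ^ k"] by (simp add: algebra_simps)
    finally show ?thesis .
  qed
qed

lemma ville_inequality:
  fixes m :: "bool list \<Rightarrow> real"
  assumes "c > 0" "\<And>w. m w \<ge> 0" "\<And>w. m (w @ [False]) + m (w @ [True]) \<le> 2 * m w"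
  shows "emeasure cantor_measure {Y. \<exists>i. c < m (prefix_seq Y i)} \<le> ennreal (m [] / c)"
proof -
  \<comment> \<open>Reading \<open>take i\<close> off one prefix of length \<open>k\<close> makes
    \<open>?E k\<close> an event about the first \<open>k\<close> bits, so the finite count
    applies.\<close>
  let ?E = "\<lambda>k. {Y. \<exists>i\<le>k. c < m (take i (prefix_seq Y k))}"
  have mono: "incseq ?E"
    unfolding incseq_def by (auto simp: take_prefix_seq) (metis le_trans take_prefix_seq)
  have sets: "range ?E \<subseteq> sets cantor_measure"
    by (rule image_subsetI) (rule sets_prefix_event)
  have "(\<exists>i. c < m (prefix_seq Y i)) \<longleftrightarrow> (\<exists>k. \<exists>i\<le>k. c < m (take i (prefix_seq Y k)))" for Y
    by (metis order_refl take_prefix_seq)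
  then have "{Y. \<exists>i. c < m (prefix_seq Y i)} = (\<Union>k. ?E k)"
    by auto
  then have "emeasure cantor_measure {Y. \<exists>i. c < m (prefix_seq Y i)} = (SUP k. emeasure cantor_measure (?E k))"
    using SUP_emeasure_incseq[OF sets mono] by simp
  also have "\<dots> \<le> ennreal (m [] / c)"
  proof (rule SUP_least)
    fix k
    have "real (card {v. length v = k \<and> (\<exists>i\<le>k. c < m (take i v))}) / 2 ^ k \<le> m [] / c"
      using ville_count[of c m k "[]"] assms by (simp add: field_simps)
    then show "emeasure cantor_measure (?E k) \<le> ennreal (m [] / c)"
      by (subst emeasure_prefix_event[of "\<lambda>v. \<exists>i\<le>k. c < m (take i v)"]) (rule ennreal_leI)
  qed
  finally show ?thesis .
qed

section \<open>From enumerated sets to gales\<close>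

text \<open>Source of all rational parameters, as fractions of naturals so that comparisons can be
  cleared of denominators and computed.\<close>

lemma nat_fraction_between:
  fixes x y :: real
  assumes "0 \<le> x" "x < y"
  obtains a b :: nat where "0 < a" "0 < b" "x < real a / real b" "real a / real b < y"
proof -
  obtain q where q: "q \<in> \<rat>" "x < q" "q < y"
    using Rats_dense_in_real[OF assms(2)] by blast
  obtain a b :: nat where ab: "b \<noteq> 0" "\<bar>q\<bar> = real a / real b"
    using Rats_abs_nat_div_natE[OF q(1)] by metis
  with q assms have "q = real a / real b" "0 < q" by auto
  with q ab show ?thesis by (intro that[of a b]) (auto simp: zero_less_divide_iff)
qed

text \<open>As \<^const>\<open>code_bits\<close> puts the first bit lowest, this says that \<open>w\<close> is a prefix of
  the string with code \<open>j\<close> followed by zeros.\<close>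

definition prefix_of_padded :: "bool list \<Rightarrow> nat \<Rightarrow> bool" where
  "prefix_of_padded w j \<longleftrightarrow> bits_val (decode j) mod 2 ^ length w = bits_val w"

text \<open>One further bit of the padded string is fixed, so a padded string below \<open>w\<close>
  lies below exactly one child of \<open>w\<close>. This is what makes the gale identity
  exact.\<close>

lemma prefix_of_padded_snoc:
  "prefix_of_padded (w @ [b]) j \<longleftrightarrow>
    prefix_of_padded w j \<and> odd (bits_val (decode j) div 2 ^ length w) = b"
proof -
  let ?K = "bits_val (decode j)" and ?n = "2 ^ length w :: nat"
  have "?K mod 2 ^ length (w @ [b]) = ?n * (?K div ?n mod 2) + ?K mod ?n"
    using mod_mult2_eq[of ?K ?n 2] by (simp add: mult.commute)
  moreover have "bits_val (w @ [b]) = ?n * of_bool b + bits_val w"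
    by (simp add: horner_sum_append)
  moreover have "?n * i + p = ?n * k + q \<longleftrightarrow> i = k \<and> p = q" if "p < ?n" "q < ?n" for i k p q
  proof
    assume eq: "?n * i + p = ?n * k + q"
    have "(?n * i + p) div ?n = i" "(?n * k + q) div ?n = k"
      "(?n * i + p) mod ?n = p" "(?n * k + q) mod ?n = q"
      using that by auto
    with eq show "i = k \<and> p = q" by simp
  qed simp
  ultimately show ?thesis
    by (auto simp: prefix_of_padded_def bits_val_less odd_iff_mod_2_eq_one)
qed

lemma prefix_of_padded_code: "prefix_of_padded w (code_bits w)"
  by (simp add: prefix_of_padded_def bits_val_less)

lemma prefix_of_padded_codes:
  "prefix_of_padded w j \<longleftrightarrow>
    (Suc j - 2 ^ code_length j) mod 2 ^ code_length (code_bits w) =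
    Suc (code_bits w) - 2 ^ code_length (code_bits w)"
proof -
  have "Suc (code_bits v) - 2 ^ code_length (code_bits v) = bits_val v" for v
    using Suc_code_bits[of v] by simp
  from this[of w] this[of "decode j"] show ?thesis
    by (simp add: prefix_of_padded_def code_length_eq)
qed

text \<open>Sorted by length, the weights are dominated by a geometric series of ratio
  \<open>2 powr r / x < 1\<close>. A code is at least as large as the length, so the first
  \<open>t\<close> codes involve only lengths below \<open>t\<close>.\<close>

lemma summable_enumeration:
  fixes U :: "bool list set" and x r :: real
  assumes card: "\<And>m. real (card {v. length v = m \<and> v \<in> U}) \<le> 2 powr (r * real m)"
    and x: "2 powr r < x"
  shows "summable (\<lambda>j. if decode j \<in> U then (1 / x) ^ length (decode j) else 0)"
proof (rule summableI_nonneg_bounded)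
  have "0 < x" using x powr_ge_zero[of 2 r] by linarith
  define q where "q = 2 powr r / x"
  have q: "0 < q" "q < 1"
    using x \<open>0 < x\<close> by (auto simp: q_def)
  let ?e = "\<lambda>j. if decode j \<in> U then (1 / x) ^ length (decode j) else 0"
  show "0 \<le> ?e j" for j using \<open>0 < x\<close> by simp
  fix t
  define V where "V = {v. length v < t \<and> v \<in> U}"
  have "finite {v :: bool list. length v \<le> t}"
    using finite_lists_length_le[of "UNIV :: bool set" t] by simp
  then have V: "finite V"
    by (rule finite_subset[rotated]) (auto simp: V_def)
  have "sum ?e {..<t} = (\<Sum>j\<in>{j. j < t \<and> decode j \<in> U}. (1 / x) ^ length (decode j))"
    by (simp add: sum.If_cases Int_def)
  also have "\<dots> = (\<Sum>v\<in>decode ` {j. j < t \<and> decode j \<in> U}. (1 / x) ^ length v)"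
    by (subst sum.reindex) (auto intro: inj_on_subset[OF inj_decode])
  also have "\<dots> \<le> (\<Sum>v\<in>V. (1 / x) ^ length v)"
    using V \<open>0 < x\<close> length_decode_le by (intro sum_mono2) (auto simp: V_def intro: le_less_trans)
  also have "\<dots> = (\<Sum>m<t. \<Sum>v\<in>{v \<in> V. length v = m}. (1 / x) ^ length v)"
    using V by (intro sum.group[symmetric]) (auto simp: V_def)
  also have "\<dots> \<le> (\<Sum>m<t. q ^ m)"
  proof (rule sum_mono)
    fix m assume "m \<in> {..<t}"
    then have "{v \<in> V. length v = m} = {v. length v = m \<and> v \<in> U}"
      by (auto simp: V_def)
    then have "(\<Sum>v\<in>{v \<in> V. length v = m}. (1 / x) ^ length v) =
        real (card {v. length v = m \<and> v \<in> U}) * (1 / x) ^ m"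
      by simp
    also have "\<dots> \<le> 2 powr (r * real m) * (1 / x) ^ m"
      using \<open>0 < x\<close> card by (intro mult_right_mono) auto
    also have "\<dots> = q ^ m"
      by (simp add: q_def power_divide powr_realpow flip: powr_powr)
    finally show "(\<Sum>v\<in>{v \<in> V. length v = m}. (1 / x) ^ length v) \<le> q ^ m" .
  qed
  also have "\<dots> \<le> (\<Sum>m. q ^ m)"
    using q by (intro sum_le_suminf summable_geometric) auto
  finally show "sum ?e {..<t} \<le> (\<Sum>m. q ^ m)" .
qed

text \<open>The gale comes from the measure that puts mass \<open>x powr - |v|\<close> on the sequence \<open>v000\<dots>\<close>
  for each enumerated \<open>v\<close>. Its exponent is chosen so that \<open>2 powr s'\<close>, rather than \<open>s'\<close>, is
  rational; this keeps all approximations of the gale rational.\<close>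

lemma gale_from_enumeration:
  fixes u :: "nat list \<Rightarrow> nat" and r s :: real
  assumes u: "computable 2 u"
    and u_mono: "\<And>j t. 0 < u [j, t] \<Longrightarrow> 0 < u [j, Suc t]"
    and card: "\<And>m. real (card {v. length v = m \<and> (\<exists>t. 0 < u [code_bits v, t])}) \<le> 2 powr (r * real m)"
    and "0 \<le> r" "r < s"
  obtains s' d where "0 \<le> s'" "s' \<le> s" "lower_semicomputable d" "is_gale s' d"
    "\<forall>X. (\<forall>\<^sub>F n in sequentially. \<exists>t. 0 < u [code_bits (prefix_seq X n), t]) \<longrightarrow> succeeds_strongly d X"
proof -
  \<comment> \<open>\<open>x\<close> above \<open>2 powr r\<close> makes the masses summable,
    \<open>y\<close> above \<open>x\<close> makes the gale grow like \<open>(y / x) ^ n\<close>, and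
    \<open>y\<close> below \<open>2 powr s\<close> keeps the exponent \<open>log 2 y\<close> at most
    \<open>s\<close>.\<close>
  obtain a b :: nat where ab: "0 < a" "0 < b" "2 powr r < real a / real b" "real a / real b < 2 powr s"
    using nat_fraction_between[of "2 powr r" "2 powr s"] \<open>r < s\<close> by auto
  obtain A B :: nat where AB: "0 < A" "0 < B" "real a / real b < real A / real B" "real A / real B < 2 powr s"
    using nat_fraction_between[OF _ ab(4)] by auto
  define x y where "x = real a / real b" and "y = real A / real B"
  have xy: "2 powr r < x" "x < y" "y < 2 powr s"
    using ab AB by (auto simp: x_def y_def)
  have "1 \<le> 2 powr r" using \<open>0 \<le> r\<close> by (simp add: ge_one_powr_ge_zero)
  then have pos: "1 < x" "1 < y" using xy by auto
  define U where "U = {v. \<exists>t. 0 < u [code_bits v, t]}"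
  define h where "h w j = (if decode j \<in> U \<and> prefix_of_padded w j
    then (1 / x) ^ length (decode j) else 0)" for w j
  define f where "f w t j = (if 0 < u [j, t] \<and> prefix_of_padded w j
    then (1 / x) ^ length (decode j) else 0)" for w t j
  define d where "d w = y ^ length w * (\<Sum>j. h w j)" for w
  define g where "g w t = y ^ length w * (\<Sum>j<t. f w t j)" for w t

  have U: "0 < u [j, t] \<Longrightarrow> decode j \<in> U" for j t
    by (auto simp: U_def)
  have h_nonneg: "0 \<le> h w j" and f_nonneg: "0 \<le> f w t j" for w t j
    using pos by (auto simp: h_def f_def)
  have f_mono: "f w t j \<le> f w (Suc t) j" and f_le_h: "f w t j \<le> h w j" for w t j
    using pos u_mono[of j t] U[of j t] by (auto simp: h_def f_def)
  have "summable (\<lambda>j. if decode j \<in> U then (1 / x) ^ length (decode j) else 0)"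
    using card xy(1) by (intro summable_enumeration[of _ r]) (auto simp: U_def)
  then have h_summable: "summable (h w)" for w
    by (rule summable_comparison_test[rotated]) (use pos in \<open>auto simp: h_def\<close>)

  have gale: "is_gale (log 2 y) d"
    unfolding is_gale_def
  proof (intro conjI allI)
    show "0 \<le> d w" for w
      using pos h_nonneg h_summable by (auto simp: d_def intro!: mult_nonneg_nonneg suminf_nonneg)
    have weight: "y ^ n * c * 2 powr (- log 2 y * real n) = c" for n c
    proof -
      have "2 powr (log 2 y * real n) = y ^ n"
        using pos by (simp add: powr_realpow flip: powr_powr)
      then show ?thesis using pos by (simp add: powr_minus field_simps)
    qed
    fix w
    have "h w j = h (w @ [False]) j + h (w @ [True]) j" for j
      by (simp add: h_def prefix_of_padded_snoc)
    then have "(\<Sum>j. h w j) = (\<Sum>j. h (w @ [False]) j) + (\<Sum>j. h (w @ [True]) j)"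
      by (simp add: suminf_add h_summable)
    then show "d w * 2 powr (- log 2 y * real (length w)) =
        d (w @ [False]) * 2 powr (- log 2 y * real (length w + 1))
      + d (w @ [True]) * 2 powr (- log 2 y * real (length w + 1))"
      unfolding d_def length_append list.size One_nat_def[symmetric] add_0 weight .
  qed

  have lsc: "lower_semicomputable d"
    unfolding lower_semicomputable_def
  proof (intro exI[of _ g] conjI allI)
    show "g w t \<le> g w (Suc t)" for w t
    proof -
      have "(\<Sum>j<t. f w t j) \<le> (\<Sum>j<Suc t. f w (Suc t) j)"
        using f_mono f_nonneg by (simp add: add_increasing2 sum_mono)
      then show ?thesis using pos by (simp add: g_def)
    qed
    show "g w t \<le> d w" for w t
    proof -
      have "(\<Sum>j<t. f w t j) \<le> (\<Sum>j<t. h w j)" by (intro sum_mono f_le_h)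
      also have "\<dots> \<le> (\<Sum>j. h w j)"
        using h_nonneg by (intro sum_le_suminf h_summable) auto
      finally show ?thesis using pos by (simp add: g_def d_def)
    qed
    show "(\<lambda>t. g w t) \<longlonglongrightarrow> d w" for w
    proof -
      \<comment> \<open>Both the terms and their number vary with \<open>t\<close>; padding with
        zeros gives series dominated by \<open>h w\<close>, to which Tannery's theorem
        applies.\<close>
      let ?f = "\<lambda>j t. if j < t then f w t j else 0"
      have lim: "(\<lambda>t. ?f j t) \<longlonglongrightarrow> h w j" for j
      proof (cases "decode j \<in> U")
        case True
        then obtain t0 where t0: "0 < u [j, t0]" by (auto simp: U_def)
        have "0 < u [j, t]" if "t0 \<le> t" for t
          using that by (induction rule: dec_induct) (auto intro: t0 u_mono)
        then have "\<forall>\<^sub>F t in sequentially. ?f j t = h w j"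
          using True by (intro eventually_sequentiallyI[of "max t0 (Suc j)"]) (auto simp: h_def f_def)
        then show ?thesis by (rule tendsto_eventually)
      next
        case False
        then have "?f j = (\<lambda>t. h w j)"
          using U[of j] by (auto simp: h_def f_def fun_eq_iff)
        then show ?thesis by simp
      qed
      have "(\<lambda>t. \<Sum>j. ?f j t) \<longlonglongrightarrow> (\<Sum>j. h w j)"
        using tannerys_theorem[OF lim, where M = "h w"] h_summable f_nonneg f_le_h h_nonneg
        by (simp add: case_prod_unfold)
      moreover have "(\<Sum>j. ?f j t) = (\<Sum>j<t. f w t j)" for t
        by (subst suminf_finite[of "{..<t}"]) auto
      ultimately show ?thesis
        unfolding g_def d_def by (intro tendsto_mult tendsto_const) simp
    qed
    show "computable_qnn g"
    proof (rule computable_qnnI)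
      \<comment> \<open>All terms are brought to the denominator \<open>a ^ t\<close>, which works
        because \<open>code_length j \<le> j < t\<close>.\<close>
      show "computable 2 (\<lambda>xs. A ^ code_length (xs ! 0) *
        (\<Sum>j<xs ! 1. (b ^ code_length j * a ^ (xs ! 1 - code_length j)) *
          of_bool (0 < u [j, xs ! 1] \<and>
            (Suc j - 2 ^ code_length j) mod 2 ^ code_length (xs ! 0) =
            Suc (xs ! 0) - 2 ^ code_length (xs ! 0))))" (is "computable 2 ?N")
        by (intro computable_intros computable_code_length computable_comp2[OF u]) auto
      \<comment> \<open>The subtracted 1 compensates for the \<open>Suc\<close> in
        \<open>computable_qnn\<close>; the product is positive.\<close>
      show "computable 2 (\<lambda>xs. B ^ code_length (xs ! 0) * a ^ (xs ! 1) - 1)" (is "computable 2 ?D")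
        by (intro computable_intros computable_code_length) auto
      show "g w t = real (?N [code_bits w, t]) / real (Suc (?D [code_bits w, t]))" for w t
      proof -
        have "f w t j = real ((b ^ code_length j * a ^ (t - code_length j)) *
            of_bool (0 < u [j, t] \<and> prefix_of_padded w j)) / real a ^ t" if "j < t" for j
        proof -
          have "code_length j \<le> t"
            using length_decode_le[of j] that by (simp add: code_length_eq)
          then have "real a ^ (t - code_length j) = real a ^ t / real a ^ code_length j"
            using ab by (intro power_diff) auto
          then show ?thesis
            using ab by (simp add: f_def x_def code_length_eq power_divide)
        qed
        then have "g w t = y ^ length w * (\<Sum>j<t. real ((b ^ code_length j * a ^ (t - code_length j)) *
            of_bool (0 < u [j, t] \<and> prefix_of_padded w j)) / real a ^ t)"
          unfolding g_def by (intro arg_cong2[of _ _ _ _ "(*)"] sum.cong) auto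
        also have "\<dots> = real (?N [code_bits w, t]) / (real B ^ length w * real a ^ t)"
          unfolding prefix_of_padded_codes sum_divide_distrib[symmetric]
          by (simp add: y_def power_divide)
        also have "real B ^ length w * real a ^ t = real (Suc (?D [code_bits w, t]))"
          using ab AB by simp
        finally show ?thesis .
      qed
    qed
  qed

  have succ: "succeeds_strongly d X"
    if X: "\<forall>\<^sub>F n in sequentially. \<exists>t. 0 < u [code_bits (prefix_seq X n), t]" for X
  proof -
    \<comment> \<open>One summand suffices: the mass \<open>(1 / x) ^ n\<close> coming from the
      prefix itself, amplified by \<open>y ^ n\<close>.\<close>
    have "(y / x) ^ n \<le> d (prefix_seq X n)" if "\<exists>t. 0 < u [code_bits (prefix_seq X n), t]" for n
    proof -
      let ?w = "prefix_seq X n"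
      have "(1 / x) ^ n = h ?w (code_bits ?w)"
        using that by (simp add: h_def U_def prefix_of_padded_code)
      also have "\<dots> \<le> (\<Sum>j. h ?w j)"
        using sum_le_suminf[OF h_summable, of "{code_bits ?w}" ?w] h_nonneg by simp
      finally have "y ^ n * (1 / x) ^ n \<le> d ?w"
        using pos by (simp add: d_def)
      then show ?thesis by (simp add: power_divide)
    qed
    with X have ge: "\<forall>\<^sub>F n in sequentially. (y / x) ^ n \<le> d (prefix_seq X n)"
      by (rule eventually_mono)
    have "1 < y / x" using xy pos by simp
    then have "filterlim (\<lambda>n. (y / x) ^ n) at_top sequentially"
      using pos by (intro filterlim_at_infinity_imp_filterlim_at_top filterlim_realpow_sequentially_gt1) auto
    then have "filterlim (\<lambda>n. d (prefix_seq X n)) at_top sequentially"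
      using ge by (rule filterlim_at_top_mono)
    then have "((\<lambda>n. ereal (d (prefix_seq X n))) \<longlongrightarrow> \<infinity>) sequentially"
      by (simp add: tendsto_PInfty_eq_at_top)
    then show ?thesis
      unfolding succeeds_strongly_def by (intro lim_imp_Liminf) auto
  qed
  have "0 \<le> log 2 y" "log 2 y \<le> s"
    using pos xy by (auto simp: log_le_iff)
  with lsc gale succ show ?thesis by (intro that) auto
qed

section \<open>From learners to gales\<close>

lemma gale_from_learner:
  assumes "0 \<le> s" "s < s'" and lsc: "lower_semicomputable (AVG l)"
    and measure: "\<And>n. emeasure cantor_measure {Y. yes_count_ge l n Y} \<le> ennreal ((1 / 2) ^ n)"
  obtains s'' d where "0 \<le> s''" "s'' \<le> s'" "lower_semicomputable d" "is_gale s'' d"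
    "\<And>X. ereal (1 - s) \<le> liminf (\<lambda>n. ereal (AVG l (prefix_seq X n))) \<Longrightarrow> succeeds_strongly d X"
proof (cases "1 \<le> s")
  case True
  \<comment> \<open>No positive \<open>a\<close> lies below \<open>1 - s\<close> now, but
    \<open>s' > 1\<close>: enumerating all strings gives a gale that succeeds on every
    sequence.\<close>
  obtain s'' d where d: "0 \<le> s''" "s'' \<le> s'" "lower_semicomputable d" "is_gale s'' d"
    "\<forall>X. succeeds_strongly d X"
    using gale_from_enumeration[OF computable_const[of 2 1], of 1 s'] True \<open>s < s'\<close>
    by (auto simp: card_all_strings powr_realpow)
  show ?thesis by (rule that[OF d(1-4)]) (simp add: d(5))
next
  case False
  \<comment> \<open>\<open>a < 1 - s\<close> makes the averages along \<open>X\<close> eventually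
    exceed \<open>a\<close>; \<open>a > 1 - s'\<close> leaves the counting exponent
    \<open>1 - a\<close> below \<open>s'\<close>.\<close>
  obtain P Q :: nat where PQ: "0 < P" "0 < Q" "max 0 (1 - s') < real P / real Q" "real P / real Q < 1 - s"
    using nat_fraction_between[of "max 0 (1 - s')" "1 - s"] False \<open>s < s'\<close> by auto
  define a where "a = real P / real Q"
  obtain g N D where ND: "trec 2 N" "trec 2 D"
      "\<And>w t. g w t = real (N [code_bits w, t]) / real (Suc (D [code_bits w, t]))"
    and g: "\<And>w t. g w t \<le> g w (Suc t)" "\<And>w t. g w t \<le> AVG l w" "\<And>w. (\<lambda>t. g w t) \<longlonglongrightarrow> AVG l w"
    using lsc unfolding lower_semicomputable_def computable_qnn_def by metis
  \<comment> \<open>The test \<open>a < g w t\<close> with denominators cleared; monotonicity of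
    \<open>g\<close> keeps it true once it succeeds.\<close>
  define u where "u xs = (of_bool (P * Suc (D xs) < Q * N xs) :: nat)" for xs
  have u_iff: "0 < u [code_bits w, t] \<longleftrightarrow> a < g w t" for w t
  proof -
    have "a < g w t \<longleftrightarrow> real P * real (Suc (D [code_bits w, t])) < real Q * real (N [code_bits w, t])"
      using PQ by (simp add: a_def ND(3) field_simps del: of_nat_Suc)
    then show ?thesis
      unfolding u_def of_nat_mult[symmetric] of_nat_less_iff by simp
  qed
  have ex_u_iff: "(\<exists>t. 0 < u [code_bits w, t]) \<longleftrightarrow> a < AVG l w" for w
  proof
    assume "a < AVG l w"
    then have "\<forall>\<^sub>F t in sequentially. a < g w t"
      using g(3) by (rule order_tendstoD(1)[rotated])
    then show "\<exists>t. 0 < u [code_bits w, t]"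
      unfolding u_iff by (rule eventually_happens'[OF sequentially_bot])
  qed (use u_iff g(2) in \<open>auto intro: less_le_trans\<close>)
  have "computable 2 u"
    unfolding u_def by (intro computable_intros computable_trec[OF ND(1)] computable_trec[OF ND(2)])
  moreover have "0 < u [j, Suc t]" if "0 < u [j, t]" for j t
    using that u_iff[of "decode j"] g(1)[of "decode j" t] by (auto intro: less_le_trans)
  moreover have "real (card {v. length v = m \<and> (\<exists>t. 0 < u [code_bits v, t])}) \<le> 2 powr ((1 - a) * real m)" for m
  proof -
    let ?n = "nat \<lceil>a * real m\<rceil>"
    have "?n \<le> yes_count l v" if "length v = m" "a < AVG l v" for v
    proof -
      have "a * real m \<le> real (yes_count l v)"
        using that by (cases "m = 0") (auto simp: AVG_yes_count field_simps)
      then show ?thesis by (simp add: nat_le_iff ceiling_le_iff)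
    qed
    then have "real (card {v. length v = m \<and> (\<exists>t. 0 < u [code_bits v, t])}) \<le>
        real (card {v. length v = m \<and> ?n \<le> yes_count l v})"
      unfolding ex_u_iff of_nat_le_iff by (intro card_mono finite_strings) auto
    also have "\<dots> \<le> 2 ^ m / 2 ^ ?n"
      by (rule card_yes_count_ge[OF measure])
    also have "\<dots> = 2 powr (real m - real ?n)"
      by (simp add: powr_diff powr_realpow)
    also have "\<dots> \<le> 2 powr ((1 - a) * real m)"
      by (intro powr_mono) (auto simp: algebra_simps real_nat_ceiling_ge)
    finally show ?thesis .
  qed
  moreover have "1 - s' < a" "a < 1 - s"
    using PQ by (simp_all add: a_def)
  then have "0 \<le> 1 - a" "1 - a < s'"
    using \<open>0 \<le> s\<close> by linarith+
  ultimately obtain s'' d where d: "0 \<le> s''" "s'' \<le> s'" "lower_semicomputable d" "is_gale s'' d"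
    "\<forall>X. (\<forall>\<^sub>F n in sequentially. \<exists>t. 0 < u [code_bits (prefix_seq X n), t]) \<longrightarrow> succeeds_strongly d X"
    by (rule gale_from_enumeration)
  show ?thesis
  proof (rule that[OF d(1-4)])
    fix X assume "ereal (1 - s) \<le> liminf (\<lambda>n. ereal (AVG l (prefix_seq X n)))"
    moreover have "ereal a < ereal (1 - s)" using PQ by (simp add: a_def)
    ultimately have "\<forall>\<^sub>F n in sequentially. ereal a < ereal (AVG l (prefix_seq X n))"
      by (intro less_LiminfD) (rule less_le_trans)
    then show "succeeds_strongly d X"
      by (intro d(5)[rule_format]) (simp add: ex_u_iff)
  qed
qed

section \<open>From gales to learners\<close>

text \<open>A strict lower bound on a limit holds eventually for its approximations, and if it fails
  for the limit it fails for everything below. Hence the strict thresholds in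
  \<open>passed\<close>.\<close>

lemma tendsto_of_bool_ex_less:
  fixes x :: "nat \<Rightarrow> nat \<Rightarrow> real"
  assumes "\<And>i t. x i t \<le> y i" "\<And>i. (\<lambda>t. x i t) \<longlonglongrightarrow> y i"
  shows "(\<lambda>t. of_bool (\<exists>i<k. c < x i t)) \<longlonglongrightarrow> (of_bool (\<exists>i<k. c < y i) :: real)"
proof (cases "\<exists>i<k. c < y i")
  case True
  then obtain i where i: "i < k" "c < y i" by blast
  have "\<forall>\<^sub>F t in sequentially. c < x i t"
    using order_tendstoD(1)[OF assms(2) i(2)] .
  then have "\<forall>\<^sub>F t in sequentially. of_bool (\<exists>i<k. c < x i t) = (of_bool (\<exists>i<k. c < y i) :: real)"
    by eventually_elim (use True i in auto)
  then show ?thesis by (rule tendsto_eventually)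
next
  case False
  then have "\<not> c < x i t" if "i < k" for i t
    using that assms(1)[of i t] by fastforce
  then have "(\<exists>i<k. c < x i t) = (\<exists>i<k. c < y i)" for t
    using False by blast
  then show ?thesis by simp
qed

text \<open>\<open>\<theta>\<close> is a rational stand-in for \<open>2 powr (1 - s)\<close>: rounding it down turns the martingale
  \<open>d w * 2 powr ((1 - s) * |w|)\<close> into a supermartingale, which is still lower semicomputable. The learner says yes
  whenever this supermartingale passes a new power of two; as it at most doubles in one step, it never
  passes two at once.\<close>

locale gale_learner =
  fixes s :: real and d :: "bool list \<Rightarrow> real" and A B C :: nat
  assumes gale: "is_gale s d"
    and AB_pos: "0 < A" "0 < B"
    and AB_le: "real A / real B \<le> 2 powr (1 - s)"
    and C: "0 < C" "d [] \<le> real C"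
begin

definition \<theta> :: real where "\<theta> = real A / real B"

definition super :: "bool list \<Rightarrow> real" where "super w = d w * \<theta> ^ length w"

text \<open>A running maximum, so the set grows along \<open>w\<close>. The exponent
  \<open>Suc n\<close> calibrates the count: for \<open>n > 0\<close>, \<open>n\<close> passed
  thresholds mean that level \<open>C * 2 ^ n\<close> was exceeded, which has measure at most
  \<open>(1 / 2) ^ n\<close> because \<open>super []\<close> is at most \<open>C\<close>.\<close>

definition passed :: "bool list \<Rightarrow> nat set" where
  "passed w = {n. \<exists>i\<le>length w. real C * 2 ^ Suc n < super (take i w)}"

definition learner :: "bool list \<Rightarrow> bool" where
  "learner w \<longleftrightarrow> w \<noteq> [] \<and> card (passed (butlast w)) < card (passed w)"

lemma \<theta>_pos: "0 < \<theta>"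
  using AB_pos by (simp add: \<theta>_def)

lemma d_nonneg: "0 \<le> d w"
  using gale by (simp add: is_gale_def)

lemma super_nonneg: "0 \<le> super w"
  using d_nonneg \<theta>_pos by (simp add: super_def)

text \<open>Over the two children the gale gains a factor \<open>2 powr s\<close>, and
  \<open>\<theta>\<close> contributes at most \<open>2 powr (1 - s)\<close>.\<close>

lemma super_le: "super (w @ [False]) + super (w @ [True]) \<le> 2 * super w"
proof -
  have "2 powr (- s * real (length w + 1)) = 2 powr (- s * real (length w)) * 2 powr (- s)"
    by (simp add: algebra_simps flip: powr_add)
  then have "2 powr (- s * real (length w)) * d w =
      2 powr (- s * real (length w)) * (2 powr (- s) * (d (w @ [False]) + d (w @ [True])))"
    using gale by (simp add: is_gale_def algebra_simps)
  then have "d w = 2 powr (- s) * (d (w @ [False]) + d (w @ [True]))"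
    by simp
  then have eq: "d (w @ [False]) + d (w @ [True]) = 2 powr s * d w"
    by (simp add: powr_minus)
  have "\<theta> * 2 powr s \<le> 2"
    using mult_right_mono[OF AB_le, of "2 powr s"] by (simp add: \<theta>_def flip: powr_add)
  then have "(\<theta> * 2 powr s) * super w \<le> 2 * super w"
    using super_nonneg by (rule mult_right_mono)
  moreover have "super (w @ [False]) + super (w @ [True]) = \<theta> ^ Suc (length w) * (d (w @ [False]) + d (w @ [True]))"
    by (simp add: super_def algebra_simps)
  ultimately show ?thesis
    unfolding eq by (simp add: super_def mult_ac)
qed

lemma super_snoc_le: "super (w @ [b]) \<le> 2 * super w"
  using super_le[of w] super_nonneg[of "w @ [False]"] super_nonneg[of "w @ [True]"] by (cases b) auto

lemma super_Nil: "super [] \<le> real C"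
  using C by (simp add: super_def)

lemma super_bound: "super w \<le> real C * 2 ^ length w"
proof (induction w rule: rev_induct)
  case Nil
  show ?case using super_Nil by simp
next
  case (snoc b w)
  then show ?case using super_snoc_le[of w b] by simp
qed

text \<open>Starting from at most \<open>C\<close> and at most doubling, \<open>super\<close> cannot
  outrun the length. Only finitely many thresholds need testing, which bounds the sum in
  \<open>AVG_learner\<close>.\<close>

lemma passed_less: "passed w \<subseteq> {..<length w}"
proof
  fix n assume "n \<in> passed w"
  then obtain i where i: "i \<le> length w" "real C * 2 ^ Suc n < super (take i w)"
    by (auto simp: passed_def)
  then have "real C * 2 ^ Suc n < real C * 2 ^ i"
    using super_bound[of "take i w"] by (simp add: min_absorb2)
  then have "(2::real) ^ Suc n < 2 ^ i"
    using C by (simp only: mult_less_cancel_left_pos of_nat_0_less_iff)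
  then have "Suc n < i"
    by (simp only: power_strict_increasing_iff)
  with i show "n \<in> {..<length w}" by simp
qed

lemma finite_passed: "finite (passed w)"
  using passed_less by (rule finite_subset) simp

text \<open>Since \<open>super\<close> at most doubles in a step, passing threshold
  \<open>Suc k\<close> at \<open>w @ [b]\<close> requires threshold \<open>k\<close> to be passed at
  \<open>w\<close>. Counting the right-hand side leaves room for one new threshold per step, so the
  answers telescope in \<open>yes_count_learner\<close>.\<close>

lemma passed_snoc:
  "passed w \<subseteq> passed (w @ [b])" "passed (w @ [b]) \<subseteq> insert 0 (Suc ` passed w)"
proof -
  show "passed w \<subseteq> passed (w @ [b])"
  proof
    fix n assume "n \<in> passed w"
    then obtain i where "i \<le> length w" "real C * 2 ^ Suc n < super (take i w)"
      by (auto simp: passed_def)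
    then show "n \<in> passed (w @ [b])"
      unfolding passed_def by (intro CollectI exI[of _ i]) simp
  qed
  show "passed (w @ [b]) \<subseteq> insert 0 (Suc ` passed w)"
  proof
    fix n assume "n \<in> passed (w @ [b])"
    then obtain i where i: "i \<le> Suc (length w)" "real C * 2 ^ Suc n < super (take i (w @ [b]))"
      by (auto simp: passed_def)
    show "n \<in> insert 0 (Suc ` passed w)"
    proof (cases n)
      case (Suc k)
      have "\<exists>i\<le>length w. real C * 2 ^ Suc k < super (take i w)"
      proof (cases "i \<le> length w")
        case True
        have "real C * 2 ^ Suc k \<le> real C * 2 ^ Suc n"
          using Suc by (intro mult_left_mono power_increasing) auto
        with True i show ?thesis by (intro exI[of _ i]) simp
      next
        case False
        with i have "real C * 2 ^ Suc n < super (w @ [b])" by simp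
        then show ?thesis
          using super_snoc_le[of w b] Suc by (intro exI[of _ "length w"]) simp
      qed
      then have "k \<in> passed w" by (simp add: passed_def)
      then show ?thesis using Suc by simp
    qed simp
  qed
qed

lemma yes_count_learner: "yes_count learner w = card (passed w)"
proof (induction w rule: rev_induct)
  case Nil
  have "passed [] = {}" using passed_less[of "[]"] by simp
  then show ?case by (simp add: yes_count_def learner_def)
next
  case (snoc b w)
  have "yes_count learner (w @ [b]) = yes_count learner w + of_bool (learner (w @ [b]))"
    by (simp add: yes_count_def)
  moreover have "card (passed w) \<le> card (passed (w @ [b]))"
    by (intro card_mono finite_passed passed_snoc)
  moreover have "card (passed (w @ [b])) \<le> Suc (card (passed w))"
  proof -
    have "card (passed (w @ [b])) \<le> card (insert 0 (Suc ` passed w))"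
      by (intro card_mono passed_snoc) (simp add: finite_passed)
    also have "\<dots> \<le> Suc (card (passed w))"
      using card_insert_le_m1[of "Suc (card (passed w))" "Suc ` passed w" 0] card_image_le[OF finite_passed, of Suc w]
      by simp
    finally show ?thesis .
  qed
  moreover have "learner (w @ [b]) \<longleftrightarrow> card (passed w) < card (passed (w @ [b]))"
    by (simp add: learner_def)
  ultimately show ?case
    using snoc by auto
qed

lemma emeasure_learner:
  "emeasure cantor_measure {Y. yes_count_ge learner n Y} \<le> ennreal ((1 / 2) ^ n)"
proof (cases n)
  case 0
  then show ?thesis using prob_space.emeasure_le_1[OF prob_space_cantor_measure] by simp
next
  case (Suc k)
  let ?E = "{Y. \<exists>i. real C * 2 ^ n < super (prefix_seq Y i)}"
  have "{Y. yes_count_ge learner n Y} \<subseteq> ?E"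
  proof clarify
    fix Y assume "yes_count_ge learner n Y"
    then obtain m where "n \<le> card (passed (prefix_seq Y m))"
      by (auto simp: yes_count_ge_iff yes_count_learner)
    \<comment> \<open>At least \<open>Suc k\<close> naturals cannot all lie below
      \<open>k\<close>.\<close>
    then have "\<not> passed (prefix_seq Y m) \<subseteq> {..<k}"
      using card_mono[of "{..<k}" "passed (prefix_seq Y m)"] Suc by auto
    then obtain j where "j \<in> passed (prefix_seq Y m)" "k \<le> j"
      by (meson lessThan_iff not_less subsetI)
    then obtain i where "real C * 2 ^ Suc j < super (prefix_seq Y i)"
      by (auto simp: passed_def take_prefix_seq)
    moreover have "real C * 2 ^ n \<le> real C * 2 ^ Suc j"
      using Suc \<open>k \<le> j\<close> by (intro mult_left_mono power_increasing) auto
    ultimately show "\<exists>i. real C * 2 ^ n < super (prefix_seq Y i)"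
      by (intro exI[of _ i]) linarith
  qed
  moreover have "?E = (\<Union>i. {Y. real C * 2 ^ n < super (prefix_seq Y i)})"
    by auto
  moreover have "\<dots> \<in> sets cantor_measure"
    by (intro sets.countable_UN) (auto intro: sets_prefix_event)
  ultimately have "emeasure cantor_measure {Y. yes_count_ge learner n Y} \<le> emeasure cantor_measure ?E"
    by (intro emeasure_mono) auto
  also have "\<dots> \<le> ennreal (super [] / (real C * 2 ^ n))"
    using C by (intro ville_inequality super_nonneg super_le) simp
  also have "\<dots> \<le> ennreal ((1 / 2) ^ n)"
    using C super_Nil by (intro ennreal_leI) (simp add: field_simps power_divide)
  finally show ?thesis .
qed

text \<open>Unfolded to strict inequalities that are monotone in \<open>d\<close>, so that
  approximations of \<open>d\<close> from below can be substituted.\<close>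

lemma AVG_learner:
  "AVG learner w = (\<Sum>n<length w. of_bool (\<exists>i<Suc (length w). real C * 2 ^ Suc n < d (take i w) * \<theta> ^ i))
    / real (length w)"
proof -
  have "passed w = {..<length w} \<inter> passed w"
    using passed_less by auto
  also have "\<dots> = {..<length w} \<inter> {n. \<exists>i<Suc (length w). real C * 2 ^ Suc n < d (take i w) * \<theta> ^ i}"
    by (auto simp: passed_def super_def min_absorb2 less_Suc_eq_le)
  finally have "real (card (passed w)) =
      (\<Sum>n<length w. of_bool (\<exists>i<Suc (length w). real C * 2 ^ Suc n < d (take i w) * \<theta> ^ i))"
    by (simp only: sum_of_bool_eq finite_lessThan)
  then show ?thesis by (simp add: AVG_yes_count yes_count_learner)
qed

lemma lower_semicomputable_AVG_learner:
  assumes "lower_semicomputable d"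
  shows "lower_semicomputable (AVG learner)"
proof -
  obtain g N D where ND: "trec 2 N" "trec 2 D"
      "\<And>w t. g w t = real (N [code_bits w, t]) / real (Suc (D [code_bits w, t]))"
    and g: "\<And>w t. g w t \<le> g w (Suc t)" "\<And>w t. g w t \<le> d w" "\<And>w. (\<lambda>t. g w t) \<longlonglongrightarrow> d w"
    using assms unfolding lower_semicomputable_def computable_qnn_def by metis
  define G where "G w t = (\<Sum>n<length w. of_bool (\<exists>i<Suc (length w). real C * 2 ^ Suc n < g (take i w) t * \<theta> ^ i))
    / real (length w)" for w t
  show ?thesis
    unfolding lower_semicomputable_def
  proof (intro exI[of _ G] conjI allI)
    have mono: "(of_bool (\<exists>i<k. c < f i * \<theta> ^ i) :: real) \<le> of_bool (\<exists>i<k. c < f' i * \<theta> ^ i)"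
      if "\<And>i. f i \<le> f' i" for f f' :: "nat \<Rightarrow> real" and c k
    proof -
      have "f i * \<theta> ^ i \<le> f' i * \<theta> ^ i" for i
        using that \<theta>_pos by (intro mult_right_mono) auto
      then show ?thesis by (auto intro: less_le_trans)
    qed
    show "G w t \<le> G w (Suc t)" for w t
      unfolding G_def by (intro divide_right_mono sum_mono mono g) simp
    show "G w t \<le> AVG learner w" for w t
      unfolding G_def AVG_learner by (intro divide_right_mono sum_mono mono g) simp
    show "(\<lambda>t. G w t) \<longlonglongrightarrow> AVG learner w" for w
      unfolding G_def AVG_learner divide_inverse
      using \<theta>_pos g(2)
      by (intro tendsto_mult tendsto_const tendsto_sum tendsto_of_bool_ex_less g(3)) auto
    let ?c = "\<lambda>c i. 2 ^ i - 1 + Suc c mod 2 ^ i"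
    show "computable_qnn G"
    proof (rule computable_qnnI)
      show "computable 2 (\<lambda>xs. \<Sum>n<code_length (xs ! 0). of_bool (\<exists>i<Suc (code_length (xs ! 0)).
          C * 2 ^ Suc n * B ^ i * Suc (D [?c (xs ! 0) i, xs ! 1]) < N [?c (xs ! 0) i, xs ! 1] * A ^ i))"
        (is "computable 2 ?N")
        by (intro computable_intros computable_code_length computable_comp2[OF computable_trec[OF ND(1)]]
            computable_comp2[OF computable_trec[OF ND(2)]]) auto
      \<comment> \<open>With the \<open>Suc\<close> of \<open>computable_qnn\<close> the denominator
        is \<open>length w\<close> for nonempty \<open>w\<close>; for \<open>w = []\<close> it is 1,
        and the empty numerator gives the value 0 that \<open>AVG\<close> has there.\<close>
      show "computable 2 (\<lambda>xs. code_length (xs ! 0) - 1)" (is "computable 2 ?D")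
        by (intro computable_intros computable_code_length) auto
      show "G w t = real (?N [code_bits w, t]) / real (Suc (?D [code_bits w, t]))" for w t
      proof -
        have "real C * 2 ^ Suc n < g (take i w) t * \<theta> ^ i \<longleftrightarrow>
            C * 2 ^ Suc n * B ^ i * Suc (D [?c (code_bits w) i, t]) < N [?c (code_bits w) i, t] * A ^ i"
          if "i < Suc (length w)" for i n
        proof -
          have "real C * 2 ^ Suc n < g (take i w) t * \<theta> ^ i \<longleftrightarrow>
            real C * 2 ^ Suc n * real B ^ i * real (Suc (D [code_bits (take i w), t]))
              < real (N [code_bits (take i w), t]) * real A ^ i"
            using AB_pos by (simp add: ND(3) \<theta>_def field_simps del: of_nat_Suc)
          also have "\<dots> \<longleftrightarrow> real (C * 2 ^ Suc n * B ^ i * Suc (D [code_bits (take i w), t]))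
              < real (N [code_bits (take i w), t] * A ^ i)"
            by (simp only: of_nat_mult of_nat_power of_nat_numeral)
          finally show ?thesis
            using that by (simp only: of_nat_less_iff code_bits_take less_Suc_eq_le)
        qed
        then have "G w t = real (?N [code_bits w, t]) / real (length w)"
          by (simp add: G_def of_nat_sum cong: conj_cong)
        then show ?thesis
          using code_length_code_bits[of "[]"] by (cases "w = []") (simp_all del: sum.lessThan_Suc)
      qed
    qed
  qed
qed

text \<open>Strong success gives \<open>d\<close> above \<open>C\<close> at all late prefixes, so
  \<open>super\<close> exceeds \<open>C * \<theta> ^ n\<close> there and about
  \<open>n * log 2 \<theta>\<close> thresholds are passed.\<close>

lemma learner_liminf:
  assumes "succeeds_strongly d X" "a < log 2 \<theta>"
  shows "ereal a \<le> liminf (\<lambda>n. ereal (AVG learner (prefix_seq X n)))"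
proof (rule Liminf_bounded)
  \<comment> \<open>Rounding down loses at most one threshold; from length \<open>K\<close> on, the
    gap \<open>log 2 \<theta> - a\<close> makes up for it.\<close>
  obtain K :: nat where K: "1 / (log 2 \<theta> - a) < real K"
    using reals_Archimedean2 by blast
  have "ereal (real C) < liminf (\<lambda>n. ereal (d (prefix_seq X n)))"
    using assms(1) by (simp add: succeeds_strongly_def)
  then have "\<forall>\<^sub>F n in sequentially. ereal (real C) < ereal (d (prefix_seq X n))"
    by (rule less_LiminfD)
  then show "\<forall>\<^sub>F n in sequentially. ereal a \<le> ereal (AVG learner (prefix_seq X n))"
    using eventually_ge_at_top[of K] eventually_gt_at_top[of 0]
  proof eventually_elim
    case (elim n)
    let ?m = "nat \<lfloor>log 2 \<theta> * real n\<rfloor>"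
    have "{..<?m} \<subseteq> passed (prefix_seq X n)"
    proof
      fix j assume "j \<in> {..<?m}"
      then have "int j < \<lfloor>log 2 \<theta> * real n\<rfloor>" by (simp add: zless_nat_eq_int_zless)
      then have "real (Suc j) \<le> log 2 \<theta> * real n" by linarith
      then have "2 powr real (Suc j) \<le> 2 powr (log 2 \<theta> * real n)"
        by (intro powr_mono) auto
      also have "2 powr (log 2 \<theta> * real n) = \<theta> ^ n"
        using \<theta>_pos by (simp add: powr_realpow flip: powr_powr)
      finally have "2 ^ Suc j \<le> \<theta> ^ n"
        by (simp only: powr_realpow zero_less_numeral)
      then have "real C * 2 ^ Suc j \<le> real C * \<theta> ^ n"
        by (rule mult_left_mono) simp
      also have "\<dots> < super (prefix_seq X n)"
        using elim(1) \<theta>_pos by (simp add: super_def)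
      finally show "j \<in> passed (prefix_seq X n)"
        unfolding passed_def by (intro CollectI exI[of _ n]) (simp add: take_prefix_seq)
    qed
    then have "?m \<le> card (passed (prefix_seq X n))"
      using card_mono[OF finite_passed, of "{..<?m}"] by simp
    then have "log 2 \<theta> * real n - 1 \<le> real (yes_count learner (prefix_seq X n))"
      unfolding yes_count_learner by linarith
    moreover have "1 \<le> (log 2 \<theta> - a) * real n"
    proof -
      have "1 / (log 2 \<theta> - a) < real n" using K elim by linarith
      then show ?thesis using assms(2) by (simp add: field_simps)
    qed
    ultimately have "a * real n \<le> real (yes_count learner (prefix_seq X n))"
      by (simp add: algebra_simps)
    then show ?case
      using elim by (simp add: AVG_yes_count field_simps)
  qed
qed

end

section \<open>Combining the two directions\<close>

lemma learner_from_gale: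
  assumes "lower_semicomputable d" "is_gale s d" "s < s'"
  obtains l where "\<And>X. succeeds_strongly d X \<Longrightarrow> strongly_alg_learns s' l X"
proof -
  \<comment> \<open>The upper bound makes \<open>super\<close> a supermartingale; the lower bound
    lifts the limiting averages to at least \<open>1 - s'\<close>.\<close>
  obtain A B :: nat where AB: "0 < A" "0 < B" "2 powr (1 - s') < real A / real B"
      "real A / real B < 2 powr (1 - s)"
    using nat_fraction_between[of "2 powr (1 - s')" "2 powr (1 - s)"] assms(3) by auto
  obtain C :: nat where C: "max 1 (d []) < real C"
    using reals_Archimedean2 by blast
  interpret gale_learner s d A B C
    using assms(2) AB C by unfold_locales auto
  have "1 - s' < log 2 \<theta>"
    using AB by (simp add: \<theta>_def less_log_iff)
  then have "strongly_alg_learns s' learner X" if "succeeds_strongly d X" for X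
    using that assms(1) emeasure_learner learner_liminf lower_semicomputable_AVG_learner
    by (simp add: strongly_alg_learns_def)
  then show ?thesis by (rule that)
qed

theorem mainTheorem9:
  fixes \<Gamma> :: "(nat \<Rightarrow> bool) set"
  shows "strong_dim \<Gamma> = Inf (G_str_constr \<Gamma>)"
proof -
  let ?D = "{s. s \<ge> 0 \<and> (\<exists>d. lower_semicomputable d \<and> is_gale s d \<and> (\<forall>X\<in>\<Gamma>. succeeds_strongly d X))}"
  let ?G = "G_str_constr \<Gamma>"
  have D_to_G: "s' \<in> ?G" if s: "s \<in> ?D" "s < s'" for s s'
  proof -
    from s obtain d where d: "lower_semicomputable d" "is_gale s d" "\<forall>X\<in>\<Gamma>. succeeds_strongly d X"
      by blast
    from learner_from_gale[OF d(1,2) s(2)] obtain l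
      where "\<And>X. succeeds_strongly d X \<Longrightarrow> strongly_alg_learns s' l X" by blast
    with d(3) s show ?thesis by (auto simp: G_str_constr_def)
  qed
  have G_to_D: "\<exists>s''\<in>?D. s'' \<le> s'" if s: "s \<in> ?G" "s < s'" for s s'
  proof (cases "\<Gamma> = {}")
    case True
    \<comment> \<open>For empty \<open>\<Gamma>\<close>, membership in \<open>?G\<close> says
      nothing about \<open>l\<close>, so the gale comes from the empty enumeration.\<close>
    from s have "0 < s'" by (auto simp: G_str_constr_def)
    then obtain s'' d where "0 \<le> s''" "s'' \<le> s'" "lower_semicomputable d" "is_gale s'' d"
      using gale_from_enumeration[OF computable_const[of 2 0], of 0 s'] by auto
    with True show ?thesis by blast
  next
    case False
    from s obtain l where l: "0 \<le> s" "\<forall>X\<in>\<Gamma>. strongly_alg_learns s l X"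
      by (auto simp: G_str_constr_def)
    with False have "lower_semicomputable (AVG l)"
      "\<And>n. emeasure cantor_measure {Y. yes_count_ge l n Y} \<le> ennreal ((1 / 2) ^ n)"
      by (auto simp: strongly_alg_learns_def)
    from gale_from_learner[OF l(1) s(2) this] obtain s'' d
      where "0 \<le> s''" "s'' \<le> s'" "lower_semicomputable d" "is_gale s'' d"
        "\<And>X. ereal (1 - s) \<le> liminf (\<lambda>n. ereal (AVG l (prefix_seq X n))) \<Longrightarrow> succeeds_strongly d X"
      by blast
    moreover from this(5) l(2) have "\<forall>X\<in>\<Gamma>. succeeds_strongly d X"
      by (simp add: strongly_alg_learns_def)
    ultimately show ?thesis by blast
  qed
  \<comment> \<open>\<open>Inf\<close> on the reals is meaningful only for nonempty sets bounded
    below, so both properties are checked for \<open>?D\<close> and \<open>?G\<close>.\<close>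
  have bdd: "bdd_below ?D" "bdd_below ?G"
    by (auto intro!: bdd_belowI[of _ 0] simp: G_str_constr_def)
  have "?D \<noteq> {}"
  proof -
    obtain s d where "0 \<le> s" "s \<le> 2" "lower_semicomputable d" "is_gale s d"
      "\<forall>X. succeeds_strongly d X"
      using gale_from_enumeration[OF computable_const[of 2 1], of 1 2]
      by (auto simp: card_all_strings powr_realpow)
    then show ?thesis by auto
  qed
  moreover from this obtain s where "s \<in> ?D" by blast
  then have "?G \<noteq> {}" using D_to_G[of s "s + 1"] by auto
  ultimately have "Inf ?D = Inf ?G"
  proof (intro antisym cInf_greatest)
    fix s assume "s \<in> ?G"
    show "Inf ?D \<le> s"
    proof (rule dense_ge)
      fix s' assume "s < s'"
      from G_to_D[OF \<open>s \<in> ?G\<close> this] show "Inf ?D \<le> s'"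
        using cInf_lower2[OF _ _ bdd(1)] by blast
    qed
  next
    fix s assume "s \<in> ?D"
    show "Inf ?G \<le> s"
    proof (rule dense_ge)
      fix s' assume "s < s'"
      from D_to_G[OF \<open>s \<in> ?D\<close> this] show "Inf ?G \<le> s'"
        by (rule cInf_lower[OF _ bdd(2)])
    qed
  qed
  then show ?thesis by (simp add: strong_dim_def)
qed

end
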